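(* Let $p_1,p_2$ be different prime numbers, let $n_1,n_2,n_3$ be positive integers such that $n_1p_1$ is coprime with $n_2p_2$, and put $N=n_1n_2n_3p_1p_2$. Let $H$ be the subgroup $H=n_3\mathbb{I}_{n_1p_1n_2p_2}$ of $\mathbb{Z}_N$, and let $K$ be a complete set of coset representatives for $\mathbb{Z}_N$ modulo $H$ such that $K$ is the disjoint union $K=K_1\cup K_2$. Let $$A=n_1p_1n_3\mathbb{I}_{n_2},\qquad B=n_2p_2n_3\mathbb{I}_{n_1},\qquad U=n_1n_2n_3p_1\mathbb{I}_{p_2},\qquad V=n_1n_2n_3p_2\mathbb{I}_{p_1}.$$ Construct $U'$ by replacing some (distinct) non-zero elements $u_1,\dots,u_n\in U$ by their sums with some non-zero elements $b_1,\dots,b_n\in B$ (not necessarily different): $$U'=\left(U\setminus\{u_1,\dots,u_n\}\right)\cup\{u_1+b_1,\dots,u_n+b_n\},$$ and construct $V'$ by replacing some (distinct) non-zero elements $v_1,\dots,v_m\in V$ by their sums with some non-zero elements $a_1,\dots,a_m\in A$ (not necessarily different): $$V'=\left(V\setminus\{v_1,\dots,v_m\}\right)\cup\{v_1+a_1,\dots,v_m+a_m\}.$$ Let $$S=A+B,\qquad R=(U+V'+K_1)\cup(U'+V+K_2).$$ If $R$ is non-periodic, then $(S,R)$ is a Vuza canon of $\mathbb{Z}_N$.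
   Context: $\mathbb{Z}_N=\{0,1,\dots,N-1\}$ denotes the cyclic group of order $N$ (addition modulo $N$). For positive integers $k,a$, $k\mathbb{I}_a=\{0,\ k\bmod N,\ 2k\bmod N,\dots,(a-1)k\bmod N\}\subseteq\mathbb{Z}_N$. Sums of subsets are $X+Y=\{x+y:x\in X,y\in Y\}$. For non-empty subsets $S,R$ of a finite cyclic group $G$, $G=S\oplus R$ means that every $g\in G$ can be written uniquely as $g=s+r$ with $s\in S$, $r\in R$. A non-empty subset $T$ of $G$ is periodic if there is $g\in G$, $g\neq0$, with $T+g=T$; otherwise it is non-periodic. A Vuza canon of $G$ is a pair $(S,R)$ of non-empty subsets of $G$ such that $G=S\oplus R$ and neither $S$ nor $R$ is periodic. *)

theory Defs
  imports "HOL-Algebra.Elementary_Groups" "HOL-Computational_Algebra.Primes"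
begin

definition multiples_mod :: "nat \<Rightarrow> nat \<Rightarrow> nat \<Rightarrow> int set" where
  "multiples_mod N k a = {int ((j * k) mod N) | j. j < a}"

definition direct_factorization :: "('a, 'b) monoid_scheme \<Rightarrow> 'a set \<Rightarrow> 'a set \<Rightarrow> bool" where
  "direct_factorization G S R \<longleftrightarrow>
     S \<noteq> {} \<and> R \<noteq> {} \<and> S \<subseteq> carrier G \<and> R \<subseteq> carrier G \<and>
     (\<forall>g\<in>carrier G. \<exists>!(s, r). s \<in> S \<and> r \<in> R \<and> g = s \<otimes>\<^bsub>G\<^esub> r)"

(* Intended for non-empty T: the empty set satisfies the formula in every non-trivial group. *)
definition periodic :: "('a, 'b) monoid_scheme \<Rightarrow> 'a set \<Rightarrow> bool" where
  "periodic G T \<longleftrightarrow> (\<exists>g\<in>carrier G. g \<noteq> \<one>\<^bsub>G\<^esub> \<and> T #>\<^bsub>G\<^esub> g = T)"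

definition vuza_canon :: "('a, 'b) monoid_scheme \<Rightarrow> 'a set \<Rightarrow> 'a set \<Rightarrow> bool" where
  "vuza_canon G S R \<longleftrightarrow>
     direct_factorization G S R \<and> \<not> periodic G S \<and> \<not> periodic G R"

definition coset_representatives :: "('a, 'b) monoid_scheme \<Rightarrow> 'a set \<Rightarrow> 'a set \<Rightarrow> bool" where
  "coset_representatives G H K \<longleftrightarrow>
     K \<subseteq> carrier G \<and> (\<forall>C\<in>rcosets\<^bsub>G\<^esub> H. \<exists>!k. k \<in> K \<inter> C)"

end

theory Submission
  imports Defs
begin

text \<open>
  Write \<open>P = n\<^sub>1 p\<^sub>1\<close> and \<open>Q = n\<^sub>2 p\<^sub>2\<close>. As \<open>P\<close> and \<open>Q\<close> are coprime, \<open>H\<close> is the direct sum of the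
  subgroups \<open>L\<close>, of order \<open>Q\<close> and generated by \<open>P n\<^sub>3\<close>, and \<open>M\<close>, of order \<open>P\<close> and generated by
  \<open>Q n\<^sub>3\<close> (lemma \<open>multiples_mod_coprime\<close>). Division with remainder by \<open>n\<^sub>2\<close> and by \<open>n\<^sub>1\<close> splits
  these further as \<open>L = A \<oplus> U\<close> and \<open>M = B \<oplus> V\<close> (lemma \<open>multiples_mod_split\<close>), so that
  \<open>H = A \<oplus> U \<oplus> B \<oplus> V = S \<oplus> (U + V)\<close>.

  The set \<open>V'\<close> arises from \<open>V\<close> by moving points along elements of \<open>A \<subseteq> L\<close>. Since \<open>L = A \<oplus> U\<close> is
  a subgroup, it absorbs these moves: \<open>L + v + a = L + v\<close>. Hence \<open>H = S \<oplus> (U + V')\<close>, and by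
  symmetry \<open>H = S \<oplus> (U' + V)\<close> (lemma \<open>direct_factorization_exchange\<close>). Thus \<open>H\<close> has two
  factorizations with the same first factor \<open>S\<close>. In each coset \<open>H + k\<close> one of them may be chosen
  freely and translated by \<open>k\<close>; the union of the translates is a complement of \<open>S\<close> in the whole
  group (lemma \<open>direct_factorization_glue\<close>). Using the first on \<open>K\<^sub>1\<close> and the second on \<open>K\<^sub>2\<close>
  gives \<open>R\<close>.

  Finally, \<open>S = A + B\<close> is non-periodic because a period of \<open>S\<close> splits into a period of \<open>A\<close> in
  \<open>L\<close> and a period of \<open>B\<close> in \<open>M\<close> (lemma \<open>not_periodic_set_mult\<close>), while \<open>A\<close> and \<open>B\<close> are
  arithmetic progressions that stop before they wrap around, and so have no period (lemma
  \<open>not_periodic_multiples_mod\<close>).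
\<close>

section \<open>Direct factorizations of groups and subgroups\<close>

lemma direct_factorizationI:
  assumes "S \<noteq> {}" "R \<noteq> {}" "S \<subseteq> carrier G" "R \<subseteq> carrier G"
    and "\<And>g. g \<in> carrier G \<Longrightarrow> \<exists>s\<in>S. \<exists>r\<in>R. g = s \<otimes>\<^bsub>G\<^esub> r"
    and "\<And>s r s' r'. \<lbrakk>s \<in> S; r \<in> R; s' \<in> S; r' \<in> R; s \<otimes>\<^bsub>G\<^esub> r = s' \<otimes>\<^bsub>G\<^esub> r'\<rbrakk>
          \<Longrightarrow> s = s' \<and> r = r'"
  shows "direct_factorization G S R"
  unfolding direct_factorization_def
proof (intro conjI ballI)
  fix g assume "g \<in> carrier G"
  then obtain s r where sr: "s \<in> S" "r \<in> R" "g = s \<otimes>\<^bsub>G\<^esub> r"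
    using assms(5) by blast
  show "\<exists>!(s, r). s \<in> S \<and> r \<in> R \<and> g = s \<otimes>\<^bsub>G\<^esub> r"
  proof (rule ex1I[of _ "(s, r)"])
    show "case (s, r) of (s, r) \<Rightarrow> s \<in> S \<and> r \<in> R \<and> g = s \<otimes>\<^bsub>G\<^esub> r" using sr by simp
  next
    fix q assume "case q of (s, r) \<Rightarrow> s \<in> S \<and> r \<in> R \<and> g = s \<otimes>\<^bsub>G\<^esub> r"
    then obtain s' r' where q: "q = (s', r')" "s' \<in> S" "r' \<in> R" "g = s' \<otimes>\<^bsub>G\<^esub> r'"
      by (cases q) simp
    have "s' = s \<and> r' = r"
      by (rule assms(6)[OF q(2,3) sr(1,2)]) (simp only: q(4)[symmetric] sr(3)[symmetric])
    then show "q = (s, r)" using q(1) by simp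
  qed
qed (rule assms(1-4))+

lemma direct_factorizationD:
  assumes "direct_factorization G S R"
  shows "S \<noteq> {}" "R \<noteq> {}" "S \<subseteq> carrier G" "R \<subseteq> carrier G"
    and "g \<in> carrier G \<Longrightarrow> \<exists>s\<in>S. \<exists>r\<in>R. g = s \<otimes>\<^bsub>G\<^esub> r"
  using assms unfolding direct_factorization_def by blast+

lemma (in monoid) direct_factorization_unique:
  assumes "direct_factorization G S R"
    and "s \<in> S" "r \<in> R" "s' \<in> S" "r' \<in> R" "s \<otimes> r = s' \<otimes> r'"
  shows "s = s' \<and> r = r'"
proof -
  have "s \<otimes> r \<in> carrier G"
    using assms(2,3) direct_factorizationD(3,4)[OF assms(1)] by auto
  then have "\<exists>!q. case q of (x, y) \<Rightarrow> x \<in> S \<and> y \<in> R \<and> s \<otimes> r = x \<otimes> y"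
    using assms(1) unfolding direct_factorization_def by blast
  then have "(s, r) = (s', r')" by (rule ex1E) (use assms(2-6) in auto)
  then show ?thesis by simp
qed

text \<open>
  A factorization \<open>H = S \<oplus> R\<close> of a subgroup is expressed as a factorization of
  \<open>G\<lparr>carrier := H\<rparr>\<close>, which has the multiplication of \<open>G\<close>. This form lets later proofs compute
  in \<open>G\<close> alone.
\<close>

lemma (in group) direct_factorization_subgroup_unique:
  assumes "subgroup H G" "direct_factorization (G\<lparr>carrier := H\<rparr>) S R"
    and "s \<in> S" "r \<in> R" "s' \<in> S" "r' \<in> R" "s \<otimes> r = s' \<otimes> r'"
  shows "s = s' \<and> r = r'"
proof -
  interpret H: group "G\<lparr>carrier := H\<rparr>"
    using assms(1) by (rule subgroup_imp_group)
  show ?thesis by (rule H.direct_factorization_unique[OF assms(2-6)]) (simp add: assms(7))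
qed

lemma (in comm_group) direct_factorization_commute:
  assumes "direct_factorization (G\<lparr>carrier := H\<rparr>) S R" "subgroup H G"
  shows "direct_factorization (G\<lparr>carrier := H\<rparr>) R S"
proof -
  note D = direct_factorizationD[OF assms(1), simplified]
  have sub: "S \<subseteq> carrier G" "R \<subseteq> carrier G"
    using D(3,4) subgroup.subset[OF assms(2)] by auto
  have comm: "r \<otimes> s = s \<otimes> r" if "r \<in> R" "s \<in> S" for r s
    using that sub by (intro m_comm) auto
  show ?thesis
  proof (rule direct_factorizationI)
    fix g assume "g \<in> carrier (G\<lparr>carrier := H\<rparr>)"
    then obtain s r where "s \<in> S" "r \<in> R" "g = s \<otimes> r" using D(5)[of g] by auto
    then show "\<exists>r\<in>R. \<exists>s\<in>S. g = r \<otimes>\<^bsub>G\<lparr>carrier := H\<rparr>\<^esub> s"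
      using comm[of r s] by (simp, metis)
  next
    fix s r s' r'
    assume "s \<in> R" "r \<in> S" "s' \<in> R" "r' \<in> S"
      and "s \<otimes>\<^bsub>G\<lparr>carrier := H\<rparr>\<^esub> r = s' \<otimes>\<^bsub>G\<lparr>carrier := H\<rparr>\<^esub> r'"
    then show "s = s' \<and> r = r'"
      using direct_factorization_subgroup_unique[OF assms(2,1), of r s r' s'] comm by auto
  qed (use D(1-4) in auto)
qed

text \<open>
  The element \<open>a b u v f(v)\<close> has \<open>M\<close>-component \<open>b v\<close>, which determines \<open>b\<close> and \<open>v\<close>, and
  \<open>L\<close>-component \<open>a u f(v)\<close>. Once \<open>v\<close> is known, \<open>f(v)\<close> is just a translation of \<open>L\<close>, and what
  remains is the factorization \<open>L = A \<oplus> U\<close>.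
\<close>

lemma (in comm_group) direct_factorization_exchange:
  assumes H: "subgroup H G" and L: "subgroup L G" and M: "subgroup M G"
    and HLM: "direct_factorization (G\<lparr>carrier := H\<rparr>) L M"
    and LAU: "direct_factorization (G\<lparr>carrier := L\<rparr>) A U"
    and MBV: "direct_factorization (G\<lparr>carrier := M\<rparr>) B V"
    and f: "f \<in> V \<rightarrow> L"
  shows "direct_factorization (G\<lparr>carrier := H\<rparr>) (A <#> B) (U <#> (\<lambda>v. v \<otimes> f v) ` V)"
proof -
  let ?V = "(\<lambda>v. v \<otimes> f v) ` V"
  note DH = direct_factorizationD[OF HLM, simplified]
    and DL = direct_factorizationD[OF LAU, simplified]
    and DM = direct_factorizationD[OF MBV, simplified]
  note HG = subgroup.mem_carrier[OF H]
  have LH: "x \<in> L \<Longrightarrow> x \<in> H" and MH: "x \<in> M \<Longrightarrow> x \<in> H" for x using DH(3,4) by auto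
  have AL: "x \<in> A \<Longrightarrow> x \<in> L" and UL: "x \<in> U \<Longrightarrow> x \<in> L" for x using DL(3,4) by auto
  have BM: "x \<in> B \<Longrightarrow> x \<in> M" and VM: "x \<in> V \<Longrightarrow> x \<in> M" for x using DM(3,4) by auto
  have fL: "f v \<in> L" if "v \<in> V" for v using f that by auto
  note mem = HG LH MH AL UL BM VM fL subgroup.m_closed[OF L] subgroup.m_closed[OF M]
  \<comment> \<open>Sorting the five summands into an \<open>L\<close>-part and an \<open>M\<close>-part.\<close>
  have sort: "(a \<otimes> b) \<otimes> (u \<otimes> (v \<otimes> f v)) = (a \<otimes> u \<otimes> f v) \<otimes> (b \<otimes> v)"
    if "a \<in> A" "b \<in> B" "u \<in> U" "v \<in> V" for a b u v
    using that by (simp add: mem m_ac)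
  show ?thesis
  proof (rule direct_factorizationI, simp_all)
    show "A <#> B \<noteq> {}" "U <#> ?V \<noteq> {}"
      using DL(1,2) DM(1,2) unfolding set_mult_def by blast+
    have "a \<otimes> b \<in> H" if "a \<in> A" "b \<in> B" for a b
      using that by (simp add: mem subgroup.m_closed[OF H])
    then show "A <#> B \<subseteq> H" unfolding set_mult_def by blast
    have "u \<otimes> (v \<otimes> f v) \<in> H" if "u \<in> U" "v \<in> V" for u v
      using that by (simp add: mem subgroup.m_closed[OF H])
    then show "U <#> ?V \<subseteq> H" unfolding set_mult_def by blast
  next
    fix g assume "g \<in> H"
    then obtain l k where lk: "l \<in> L" "k \<in> M" "g = l \<otimes> k" using DH(5) by blast
    obtain b v where bv: "b \<in> B" "v \<in> V" "k = b \<otimes> v" using DM(5) lk by blast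
    have "l \<otimes> inv (f v) \<in> L"
      using lk bv fL L by (simp add: subgroup.m_closed subgroup.m_inv_closed)
    then obtain a u where au: "a \<in> A" "u \<in> U" "l \<otimes> inv (f v) = a \<otimes> u" using DL(5) by blast
    have "l = a \<otimes> u \<otimes> f v"
      using lk bv by (simp add: au(3)[symmetric] mem m_assoc)
    then have "g = (a \<otimes> b) \<otimes> (u \<otimes> (v \<otimes> f v))"
      using sort au bv lk by simp
    then show "\<exists>s\<in>A <#> B. \<exists>r\<in>U <#> ?V. g = s \<otimes> r"
      using au bv unfolding set_mult_def by blast
  next
    fix s r s' r'
    assume "s \<in> A <#> B" "r \<in> U <#> ?V" "s' \<in> A <#> B" "r' \<in> U <#> ?V"
      and eq: "s \<otimes> r = s' \<otimes> r'"
    then obtain a b u v a' b' u' v' where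
      m: "a \<in> A" "b \<in> B" "u \<in> U" "v \<in> V" "a' \<in> A" "b' \<in> B" "u' \<in> U" "v' \<in> V"
      and e: "s = a \<otimes> b" "r = u \<otimes> (v \<otimes> f v)" "s' = a' \<otimes> b'" "r' = u' \<otimes> (v' \<otimes> f v')"
      unfolding set_mult_def by blast
    have "(a \<otimes> u \<otimes> f v) \<otimes> (b \<otimes> v) = (a' \<otimes> u' \<otimes> f v') \<otimes> (b' \<otimes> v')"
      using eq m by (simp add: e sort)
    then have 1: "a \<otimes> u \<otimes> f v = a' \<otimes> u' \<otimes> f v'" and 2: "b \<otimes> v = b' \<otimes> v'"
      using direct_factorization_subgroup_unique[OF H HLM,
          of "a \<otimes> u \<otimes> f v" "b \<otimes> v" "a' \<otimes> u' \<otimes> f v'" "b' \<otimes> v'"] m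
      by (simp_all add: mem)
    from 2 have bv: "b = b'" "v = v'"
      using direct_factorization_subgroup_unique[OF M MBV, of b v b' v'] m by simp_all
    have "a \<otimes> u = a' \<otimes> u'"
      using 1 m by (simp add: bv mem)
    then have "a = a'" "u = u'"
      using direct_factorization_subgroup_unique[OF L LAU, of a u a' u'] m by simp_all
    then show "s = s' \<and> r = r'" using bv e by simp
  qed
qed

text \<open>
  The injectivity of \<open>u\<close> makes the replacement a function of the replaced element, which turns
  \<open>U'\<close> and \<open>V'\<close> into the shape required by the exchange lemma.
\<close>

lemma (in monoid) replacement_eq_image:
  assumes "U \<subseteq> carrier G" "inj_on u I" "u ` I \<subseteq> U" "b ` I \<subseteq> L" "\<one> \<in> L"
  obtains f where "f \<in> U \<rightarrow> L"
    and "(U - u ` I) \<union> (\<lambda>i. u i \<otimes> b i) ` I = (\<lambda>x. x \<otimes> f x) ` U"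
proof
  let ?f = "\<lambda>x. if x \<in> u ` I then b (inv_into I u x) else \<one>"
  show "?f \<in> U \<rightarrow> L"
    using assms by (auto simp: inv_into_f_f image_subset_iff)
  have "(\<lambda>x. x \<otimes> ?f x) ` (U - u ` I) = (\<lambda>x. x) ` (U - u ` I)"
    using assms(1) by (intro image_cong) auto
  moreover have "(\<lambda>x. x \<otimes> ?f x) ` (u ` I) = (\<lambda>i. u i \<otimes> b i) ` I"
    unfolding image_image using assms(2) by (intro image_cong) (auto simp: inv_into_f_f)
  moreover have "(\<lambda>x. x \<otimes> ?f x) ` U
      = (\<lambda>x. x \<otimes> ?f x) ` (U - u ` I) \<union> (\<lambda>x. x \<otimes> ?f x) ` (u ` I)"
    unfolding image_Un[symmetric] using assms(3) by (simp only: Un_Diff_cancel2 Un_absorb2)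
  ultimately show "(U - u ` I) \<union> (\<lambda>i. u i \<otimes> b i) ` I = (\<lambda>x. x \<otimes> ?f x) ` U"
    by (simp only: image_ident)
qed

section \<open>Gluing factorizations along a transversal\<close>

lemma (in group) coset_representatives_direct_factorization:
  assumes H: "subgroup H G" and K: "coset_representatives G H K"
  shows "direct_factorization G H K"
proof -
  have KG: "K \<subseteq> carrier G" using K unfolding coset_representatives_def by blast
  have ex1: "\<exists>!k. k \<in> K \<inter> (H #> g)" if "g \<in> carrier G" for g
  proof -
    have "\<forall>C\<in>rcosets H. \<exists>!k. k \<in> K \<inter> C"
      using K unfolding coset_representatives_def by (rule conjunct2)
    then show ?thesis using rcosetsI[OF subgroup.subset[OF H] that] by (rule bspec)
  qed
  have ex: "\<exists>h\<in>H. \<exists>k\<in>K. g = h \<otimes> k" if g: "g \<in> carrier G" for g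
  proof -
    obtain k where k: "k \<in> K" "k \<in> H #> g" using ex1[OF g] by blast
    then have "g \<in> H #> k"
      using repr_independence[OF k(2) g H] rcos_self[OF g H] by simp
    then show ?thesis using k unfolding r_coset_def by blast
  qed
  show ?thesis
  proof (rule direct_factorizationI)
    show "H \<noteq> {}" using subgroup.one_closed[OF H] by blast
    show "H \<subseteq> carrier G" by (rule subgroup.subset[OF H])
    show "K \<noteq> {}" using ex[OF one_closed] by blast
  next
    fix s r s' r'
    assume m: "s \<in> H" "r \<in> K" "s' \<in> H" "r' \<in> K" and eq: "s \<otimes> r = s' \<otimes> r'"
    note c = subgroup.mem_carrier[OF H] subsetD[OF KG]
    \<comment> \<open>Both \<open>r\<close> and \<open>r'\<close> represent the coset of the common product.\<close>
    have g: "s \<otimes> r \<in> carrier G" using m c by simp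
    have coset: "y \<in> H #> (x \<otimes> y)" if "x \<in> H" "y \<in> K" for x y
    proof -
      have "y = inv x \<otimes> (x \<otimes> y)" using that c by (simp add: m_assoc[symmetric])
      then show ?thesis
        using subgroup.m_inv_closed[OF H that(1)] unfolding r_coset_def by blast
    qed
    have "r \<in> K \<inter> (H #> (s \<otimes> r))" "r' \<in> K \<inter> (H #> (s \<otimes> r))"
      using coset[OF m(1,2)] coset[OF m(3,4)] m eq by simp_all
    then have "r = r'" using ex1[OF g] by blast
    then show "s = s' \<and> r = r'" using eq m c by simp
  next
    show "\<exists>s\<in>H. \<exists>r\<in>K. g = s \<otimes> r" if "g \<in> carrier G" for g using ex[OF that] .
  qed (rule KG)
qed

text \<open>
  A product \<open>s r k\<close> with \<open>r \<in> R k\<close> determines \<open>k\<close>, since \<open>s r \<in> H\<close>; then \<open>s\<close> and \<open>r\<close> are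
  determined by the factorization of \<open>H\<close> attached to \<open>k\<close>. Nothing relates the complements \<open>R k\<close>
  for different \<open>k\<close>, which is what makes non-periodic complements possible.
\<close>

lemma (in group) direct_factorization_glue:
  assumes H: "subgroup H G" and GHK: "direct_factorization G H K"
    and HSR: "\<And>k. k \<in> K \<Longrightarrow> direct_factorization (G\<lparr>carrier := H\<rparr>) S (R k)"
  shows "direct_factorization G S (\<Union>k\<in>K. R k #> k)"
proof -
  note DG = direct_factorizationD[OF GHK]
    and DH = direct_factorizationD[OF HSR, simplified]
  note c = subgroup.mem_carrier[OF H] subsetD[OF DG(4)]
  have S: "S \<noteq> {}" "x \<in> S \<Longrightarrow> x \<in> H" for x using DG(2) DH(1,3) by blast+
  have R: "R k \<noteq> {}" "x \<in> R k \<Longrightarrow> x \<in> H" if "k \<in> K" for x k using DH(2,4) that by blast+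
  note mem = c S(2) R(2)
  show ?thesis
  proof (rule direct_factorizationI)
    obtain k where k: "k \<in> K" using DG(2) by blast
    with R(1)[OF k] show "(\<Union>k\<in>K. R k #> k) \<noteq> {}" unfolding r_coset_def by blast
    have "r \<otimes> k \<in> carrier G" if "k \<in> K" "r \<in> R k" for k r
      using that by (simp add: mem)
    then show "(\<Union>k\<in>K. R k #> k) \<subseteq> carrier G" unfolding r_coset_def by blast
  next
    fix g assume "g \<in> carrier G"
    then obtain h k where hk: "h \<in> H" "k \<in> K" "g = h \<otimes> k" using DG(5) by blast
    obtain s r where sr: "s \<in> S" "r \<in> R k" "h = s \<otimes> r"
      using DH(5)[OF hk(2,1)] by blast
    have "g = s \<otimes> (r \<otimes> k)" using hk sr by (simp add: mem m_assoc)
    then show "\<exists>s\<in>S. \<exists>r\<in>\<Union>k\<in>K. R k #> k. g = s \<otimes> r"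
      using hk sr unfolding r_coset_def by blast
  next
    fix s x s' x'
    assume s: "s \<in> S" "s' \<in> S" and "x \<in> (\<Union>k\<in>K. R k #> k)" "x' \<in> (\<Union>k\<in>K. R k #> k)"
      and eq: "s \<otimes> x = s' \<otimes> x'"
    then obtain k r k' r' where m: "k \<in> K" "r \<in> R k" "k' \<in> K" "r' \<in> R k'"
      and e: "x = r \<otimes> k" "x' = r' \<otimes> k'" unfolding r_coset_def by blast
    have "(s \<otimes> r) \<otimes> k = (s' \<otimes> r') \<otimes> k'" using eq s m by (simp add: e mem m_assoc)
    moreover have "s \<otimes> r \<in> H" "s' \<otimes> r' \<in> H"
      using s m by (simp_all add: mem subgroup.m_closed[OF H])
    ultimately have 1: "s \<otimes> r = s' \<otimes> r'" and k: "k = k'"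
      using direct_factorization_unique[OF GHK, of "s \<otimes> r" k "s' \<otimes> r'" k'] m by simp_all
    have "s = s' \<and> r = r'"
      using direct_factorization_subgroup_unique[OF H HSR[OF m(1)], of s r s' r'] 1 s m k by simp
    then show "s = s' \<and> x = x'" using e k by simp
  next
    show "S \<subseteq> carrier G" using mem by blast
  qed (rule S(1))
qed

section \<open>Periods of a product of two sets\<close>

lemma (in group) r_coset_fixed_closed:
  assumes "T \<subseteq> carrier G" "g \<in> carrier G" "T #> g = T" "t \<in> T"
  shows "t \<otimes> g \<in> T" "t \<otimes> inv g \<in> T"
proof -
  show "t \<otimes> g \<in> T" using assms unfolding r_coset_def by blast
  have "T #> inv g = T" using coset_mult_assoc[of T g "inv g"] assms by simp
  then show "t \<otimes> inv g \<in> T" using assms(4) unfolding r_coset_def by blast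
qed

lemma (in group) r_coset_fixedI:
  assumes "T \<subseteq> carrier G" "g \<in> carrier G"
    and "\<And>t. t \<in> T \<Longrightarrow> t \<otimes> g \<in> T" "\<And>t. t \<in> T \<Longrightarrow> t \<otimes> inv g \<in> T"
  shows "T #> g = T"
proof
  show "T #> g \<subseteq> T" using assms(3) unfolding r_coset_def by blast
  show "T \<subseteq> T #> g"
  proof
    fix t assume t: "t \<in> T"
    then have "t = (t \<otimes> inv g) \<otimes> g" using assms(1,2) by (auto simp: m_assoc)
    then show "t \<in> T #> g" using assms(4)[OF t] unfolding r_coset_def by blast
  qed
qed

text \<open>
  A period of a non-empty subset of \<open>H\<close> lies in \<open>H\<close>, so it has components in \<open>L\<close> and \<open>M\<close>. The
  uniqueness of components shows that they and their inverses translate \<open>A\<close> and \<open>B\<close> into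
  themselves; as \<open>A\<close> and \<open>B\<close> have no period, both components are trivial.
\<close>

lemma (in comm_group) not_periodic_set_mult:
  assumes H: "subgroup H G" and L: "subgroup L G" and M: "subgroup M G"
    and HLM: "direct_factorization (G\<lparr>carrier := H\<rparr>) L M"
    and A: "A \<subseteq> L" "A \<noteq> {}" "\<not> periodic G A" and B: "B \<subseteq> M" "B \<noteq> {}" "\<not> periodic G B"
  shows "\<not> periodic G (A <#> B)"
proof
  assume "periodic G (A <#> B)"
  then obtain g where g: "g \<in> carrier G" "g \<noteq> \<one>" "(A <#> B) #> g = A <#> B"
    unfolding periodic_def by blast
  note DH = direct_factorizationD[OF HLM, simplified]
  note LG = subgroup.mem_carrier[OF L] and MG = subgroup.mem_carrier[OF M]
  note mem = LG MG subsetD[OF A(1)] subsetD[OF B(1)]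
  have "a \<otimes> b \<in> H" if "a \<in> A" "b \<in> B" for a b
    using that A(1) B(1) DH(3,4) by (intro subgroup.m_closed[OF H]) auto
  then have SH: "A <#> B \<subseteq> H" unfolding set_mult_def by blast
  have SG: "A <#> B \<subseteq> carrier G" using SH subgroup.subset[OF H] by blast
  obtain a0 b0 where ab0: "a0 \<in> A" "b0 \<in> B" using A B by blast
  then have s0: "a0 \<otimes> b0 \<in> A <#> B" unfolding set_mult_def by blast
  have "inv (a0 \<otimes> b0) \<otimes> ((a0 \<otimes> b0) \<otimes> g) \<in> H"
    by (rule subgroup.m_closed[OF H subgroup.m_inv_closed[OF H]])
      (rule subsetD[OF SH s0] subsetD[OF SH r_coset_fixed_closed(1)[OF SG g(1,3) s0]])+
  then have "g \<in> H" using s0 SG g(1) by (simp add: m_assoc[symmetric] subset_iff)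
  then obtain l k where lk: "l \<in> L" "k \<in> M" "g = l \<otimes> k" using DH(5) by blast
  have comp: "a \<otimes> l' \<in> A \<and> b \<otimes> k' \<in> B"
    if m: "a \<in> A" "b \<in> B" "l' \<in> L" "k' \<in> M" "(a \<otimes> b) \<otimes> (l' \<otimes> k') \<in> A <#> B" for a b l' k'
  proof -
    obtain a' b' where ab': "a' \<in> A" "b' \<in> B" "(a \<otimes> b) \<otimes> (l' \<otimes> k') = a' \<otimes> b'"
      using m(5) unfolding set_mult_def by blast
    have "(a \<otimes> l') \<otimes> (b \<otimes> k') = a' \<otimes> b'" using ab' m by (simp add: mem m_ac)
    moreover have "a \<otimes> l' \<in> L" "b \<otimes> k' \<in> M"
      using m by (simp_all add: mem subgroup.m_closed[OF L] subgroup.m_closed[OF M])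
    ultimately have "a \<otimes> l' = a' \<and> b \<otimes> k' = b'"
      using direct_factorization_subgroup_unique[OF H HLM, of "a \<otimes> l'" "b \<otimes> k'" a' b'] ab'
      by (simp add: mem)
    then show ?thesis using ab' by simp
  qed
  have inv_g: "inv g = inv l \<otimes> inv k" using lk mem by (simp add: inv_mult)
  have fwd: "a \<otimes> l \<in> A \<and> b \<otimes> k \<in> B" and bwd: "a \<otimes> inv l \<in> A \<and> b \<otimes> inv k \<in> B"
    if "a \<in> A" "b \<in> B" for a b
  proof -
    have s: "a \<otimes> b \<in> A <#> B" using that unfolding set_mult_def by blast
    show "a \<otimes> l \<in> A \<and> b \<otimes> k \<in> B"
      using r_coset_fixed_closed(1)[OF SG g(1,3) s] unfolding lk(3) by (rule comp[OF that lk(1,2)])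
    show "a \<otimes> inv l \<in> A \<and> b \<otimes> inv k \<in> B"
      using r_coset_fixed_closed(2)[OF SG g(1,3) s] unfolding inv_g
      by (rule comp[OF that subgroup.m_inv_closed[OF L lk(1)] subgroup.m_inv_closed[OF M lk(2)]])
  qed
  have "A #> l = A"
  proof (rule r_coset_fixedI)
    show "A \<subseteq> carrier G" "l \<in> carrier G" using lk mem by blast+
    show "t \<otimes> l \<in> A" "t \<otimes> inv l \<in> A" if "t \<in> A" for t
      using fwd[OF that ab0(2)] bwd[OF that ab0(2)] by blast+
  qed
  moreover have "B #> k = B"
  proof (rule r_coset_fixedI)
    show "B \<subseteq> carrier G" "k \<in> carrier G" using lk mem by blast+
    show "t \<otimes> k \<in> B" "t \<otimes> inv k \<in> B" if "t \<in> B" for t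
      using fwd[OF ab0(1) that] bwd[OF ab0(1) that] by blast+
  qed
  moreover have "l \<in> carrier G" "k \<in> carrier G" using lk mem by simp_all
  ultimately have "l = \<one>" "k = \<one>"
    using A(3) B(3) unfolding periodic_def by blast+
  then show False using lk g by simp
qed

section \<open>Arithmetic progressions in a cyclic group\<close>

text \<open>
  The bound \<open>a k \<le> N\<close> keeps the progression from wrapping around, so its terms need no reduction.
\<close>

lemma multiples_mod_eq:
  assumes "a * k \<le> N"
  shows "multiples_mod N k a = {int (j * k) | j. j < a}"
proof -
  have "j * k mod N = j * k" if "j < a" for j
  proof (cases "k = 0")
    case False
    then have "j * k < a * k" using that by simp
    then have "j * k < N" using assms by (rule less_le_trans)
    then show ?thesis by (rule mod_less)
  qed simp
  then have "x = int (j * k mod N) \<and> j < a \<longleftrightarrow> x = int (j * k) \<and> j < a" for x j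
    by (cases "j < a") simp_all
  then show ?thesis unfolding multiples_mod_def by (intro Collect_cong ex_cong1)
qed

lemma int_mod_mem_multiples_mod:
  assumes "N = a * k" "N > 0" "int k dvd x"
  shows "x mod int N \<in> multiples_mod N k a"
proof -
  obtain y where y: "x = int k * y" using assms(3) by blast
  have a: "a > 0" using assms(1,2) by simp
  have "x mod int N = int k * (y mod int a)"
    unfolding y assms(1) of_nat_mult mult.commute[of "int a"] by (simp only: mult_mod_right)
  also have "\<dots> = int (nat (y mod int a) * k)"
    using a by simp
  finally have "x mod int N = int (nat (y mod int a) * k)" .
  moreover have "nat (y mod int a) < a" using a by (simp add: nat_less_iff)
  moreover have "multiples_mod N k a = {int (j * k) | j. j < a}"
    by (rule multiples_mod_eq) (simp add: assms(1))
  ultimately show ?thesis by blast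
qed

lemma subgroup_multiples_mod:
  assumes "N = a * k" "N > 0"
  shows "subgroup (multiples_mod N k a) (integer_mod_group N)"
proof -
  interpret comm_group "integer_mod_group N" by (rule abelian_integer_mod_group)
  have eq: "multiples_mod N k a = {int (j * k) | j. j < a}"
    using assms by (simp add: multiples_mod_eq)
  show ?thesis
  proof (rule subgroupI)
    show "multiples_mod N k a \<subseteq> carrier (integer_mod_group N)"
      using assms unfolding multiples_mod_def by (auto simp: carrier_integer_mod_group)
    show "multiples_mod N k a \<noteq> {}"
      using assms unfolding multiples_mod_def by auto
  next
    fix x assume x: "x \<in> multiples_mod N k a"
    then have "x \<in> carrier (integer_mod_group N)" "int k dvd x"
      using assms unfolding eq by (auto simp: carrier_integer_mod_group)
    then show "inv\<^bsub>integer_mod_group N\<^esub> x \<in> multiples_mod N k a"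
      using int_mod_mem_multiples_mod[OF assms, of "- x"] by (simp add: inv_integer_mod_group)
  next
    fix x y assume "x \<in> multiples_mod N k a" "y \<in> multiples_mod N k a"
    then have "int k dvd x" "int k dvd y" unfolding eq by auto
    then show "x \<otimes>\<^bsub>integer_mod_group N\<^esub> y \<in> multiples_mod N k a"
      using int_mod_mem_multiples_mod[OF assms, of "x + y"] by (simp add: mult_integer_mod_group)
  qed
qed

text \<open>
  This is division with remainder: each \<open>t < a c\<close> is uniquely \<open>i + a j\<close> with \<open>i < a\<close> and
  \<open>j < c\<close>. The sums stay below \<open>N\<close>, so no reduction interferes.
\<close>

lemma multiples_mod_split:
  assumes "N = a * c * k" "N > 0"
  shows "direct_factorization ((integer_mod_group N)\<lparr>carrier := multiples_mod N k (a * c)\<rparr>)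
           (multiples_mod N k a) (multiples_mod N (a * k) c)"
proof -
  have pos: "a > 0" "c > 0" "k > 0" using assms by auto
  have "a * k \<le> N" "c * (a * k) \<le> N" "a * c * k \<le> N"
    using pos unfolding assms(1) by simp_all
  then have eqs: "multiples_mod N k a = {int (i * k) | i. i < a}"
    "multiples_mod N (a * k) c = {int (j * (a * k)) | j. j < c}"
    "multiples_mod N k (a * c) = {int (i * k) | i. i < a * c}"
    by (simp_all only: multiples_mod_eq)
  have lt: "i + a * j < a * c" if "i < a" "j < c" for i j
  proof -
    have "i + a * j < a * (j + 1)" using that by simp
    also have "\<dots> \<le> a * c" using that by (intro mult_left_mono) auto
    finally show ?thesis .
  qed
  have add: "(int (i * k) + int (j * (a * k))) mod int N = int ((i + a * j) * k)"
    if "i < a" "j < c" for i j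
  proof -
    have "(i + a * j) * k < N" using lt[OF that] assms pos by simp
    moreover have "i * k + j * (a * k) = (i + a * j) * k" by (simp add: algebra_simps)
    ultimately show ?thesis by (simp only: of_nat_add[symmetric] of_nat_mod[symmetric] mod_less)
  qed
  show ?thesis
  proof (rule direct_factorizationI, simp_all add: mult_integer_mod_group)
    show "multiples_mod N k a \<noteq> {}" "multiples_mod N (a * k) c \<noteq> {}"
      using pos unfolding eqs by auto
    show "multiples_mod N k a \<subseteq> multiples_mod N k (a * c)"
    proof -
      have "i < a * c" if "i < a" for i using lt[OF that pos(2)] by (simp add: mult_less_cancel1)
      then show ?thesis unfolding eqs by blast
    qed
    show "multiples_mod N (a * k) c \<subseteq> multiples_mod N k (a * c)"
    proof
      fix x assume "x \<in> multiples_mod N (a * k) c"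
      then obtain j where j: "j < c" "x = int (j * (a * k))" unfolding eqs by blast
      have "a * j < a * c" "x = int ((a * j) * k)" using j pos by simp_all
      then show "x \<in> multiples_mod N k (a * c)" unfolding eqs(3) by blast
    qed
  next
    fix g assume "g \<in> multiples_mod N k (a * c)"
    then obtain t where t: "t < a * c" "g = int (t * k)" unfolding eqs by blast
    have "t mod a < a" "t div a < c"
      using t pos by (simp_all add: less_mult_imp_div_less mult.commute)
    moreover have "g = (int (t mod a * k) + int (t div a * (a * k))) mod int N"
      using add[OF calculation] t by simp
    ultimately show "\<exists>s\<in>multiples_mod N k a. \<exists>r\<in>multiples_mod N (a * k) c. g = (s + r) mod int N"
      unfolding eqs by blast
  next
    fix s r s' r'
    assume m: "s \<in> multiples_mod N k a" "r \<in> multiples_mod N (a * k) c"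
      "s' \<in> multiples_mod N k a" "r' \<in> multiples_mod N (a * k) c"
      and eq: "(s + r) mod int N = (s' + r') mod int N"
    obtain i j i' j' where ij: "i < a" "j < c" "i' < a" "j' < c"
      "s = int (i * k)" "r = int (j * (a * k))" "s' = int (i' * k)" "r' = int (j' * (a * k))"
      using m unfolding eqs by blast
    have "(i + a * j) * k = (i' + a * j') * k"
      using eq add ij by (metis of_nat_eq_iff)
    then have e: "i + a * j = i' + a * j'" using pos by simp
    have "i = i'" using arg_cong[OF e, of "\<lambda>t. t mod a"] ij by simp
    moreover have "j = j'" using e pos calculation by simp
    ultimately show "s = s' \<and> r = r'" using ij by simp
  qed
qed

text \<open>
  This is the Chinese remainder theorem, in the form that a cyclic group of order \<open>P Q\<close> is the
  direct sum of its subgroups of order \<open>Q\<close> and \<open>P\<close>. Existence comes from a Bezout identity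
  \<open>x P + y Q = 1\<close>, uniqueness from reducing modulo \<open>Q\<close> and modulo \<open>P\<close>.
\<close>

lemma multiples_mod_coprime:
  assumes "N = P * Q * k" "N > 0" "coprime P Q"
  shows "direct_factorization ((integer_mod_group N)\<lparr>carrier := multiples_mod N k (P * Q)\<rparr>)
           (multiples_mod N (P * k) Q) (multiples_mod N (Q * k) P)"
proof -
  have pos: "P > 0" "Q > 0" "k > 0" using assms by auto
  have "Q * (P * k) \<le> N" "P * (Q * k) \<le> N" "P * Q * k \<le> N"
    unfolding assms(1) by simp_all
  then have eqs: "multiples_mod N (P * k) Q = {int (i * (P * k)) | i. i < Q}"
    "multiples_mod N (Q * k) P = {int (j * (Q * k)) | j. j < P}"
    "multiples_mod N k (P * Q) = {int (i * k) | i. i < P * Q}"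
    by (simp_all only: multiples_mod_eq)
  show ?thesis
  proof (rule direct_factorizationI, simp_all add: mult_integer_mod_group)
    show "multiples_mod N (P * k) Q \<noteq> {}" "multiples_mod N (Q * k) P \<noteq> {}"
      using pos unfolding eqs by auto
    show "multiples_mod N (P * k) Q \<subseteq> multiples_mod N k (P * Q)"
    proof
      fix x assume "x \<in> multiples_mod N (P * k) Q"
      then obtain j where j: "j < Q" "x = int (j * (P * k))" unfolding eqs by blast
      have "P * j < P * Q" "x = int ((P * j) * k)" using j pos by simp_all
      then show "x \<in> multiples_mod N k (P * Q)" unfolding eqs(3) by blast
    qed
    show "multiples_mod N (Q * k) P \<subseteq> multiples_mod N k (P * Q)"
    proof
      fix x assume "x \<in> multiples_mod N (Q * k) P"
      then obtain j where j: "j < P" "x = int (j * (Q * k))" unfolding eqs by blast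
      have "j * Q < P * Q" "x = int ((j * Q) * k)" using j pos by simp_all
      then show "x \<in> multiples_mod N k (P * Q)" unfolding eqs(3) by blast
    qed
  next
    fix g assume "g \<in> multiples_mod N k (P * Q)"
    then obtain t where t: "t < P * Q" "g = int (t * k)" unfolding eqs by blast
    obtain x y where bez: "x * int P + y * int Q = 1"
      using assms(3) by (metis bezout_int coprime_imp_gcd_eq_1 coprime_int_iff)
    define s where "s = (int t * x * int (P * k)) mod int N"
    define r where "r = (int t * y * int (Q * k)) mod int N"
    have "s \<in> multiples_mod N (P * k) Q" unfolding s_def
      by (rule int_mod_mem_multiples_mod) (use assms in \<open>auto simp: mult_ac\<close>)
    moreover have "r \<in> multiples_mod N (Q * k) P" unfolding r_def
      by (rule int_mod_mem_multiples_mod) (use assms in \<open>auto simp: mult_ac\<close>)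
    moreover have "g = (s + r) mod int N"
    proof -
      have "(s + r) mod int N
          = (int t * x * int (P * k) + int t * y * int (Q * k)) mod int N"
        unfolding s_def r_def by (simp add: mod_add_eq)
      also have "int t * x * int (P * k) + int t * y * int (Q * k)
          = int t * int k * (x * int P + y * int Q)" by (simp add: algebra_simps)
      also have "\<dots> = int (t * k)" using bez by simp
      also have "int (t * k) mod int N = int (t * k)"
        using t assms(1) pos by (simp only: of_nat_mod[symmetric]) simp
      finally show ?thesis using t by simp
    qed
    ultimately show "\<exists>s\<in>multiples_mod N (P * k) Q. \<exists>r\<in>multiples_mod N (Q * k) P.
        g = (s + r) mod int N" by blast
  next
    fix s r s' r'
    assume m: "s \<in> multiples_mod N (P * k) Q" "r \<in> multiples_mod N (Q * k) P"
      "s' \<in> multiples_mod N (P * k) Q" "r' \<in> multiples_mod N (Q * k) P"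
      and eq: "(s + r) mod int N = (s' + r') mod int N"
    obtain i j i' j' where ij: "i < Q" "j < P" "i' < Q" "j' < P"
      "s = int (i * (P * k))" "r = int (j * (Q * k))"
      "s' = int (i' * (P * k))" "r' = int (j' * (Q * k))"
      using m unfolding eqs by blast
    have "int k * (int P * int Q) dvd (s + r) - (s' + r')"
      using eq assms(1) by (simp add: mod_eq_dvd_iff mult_ac)
    also have "(s + r) - (s' + r')
        = int k * (int P * (int i - int i') + int Q * (int j - int j'))"
      using ij by (simp add: algebra_simps)
    finally have d: "int P * int Q dvd int P * (int i - int i') + int Q * (int j - int j')"
      using pos by simp
    have "int Q dvd int P * (int i - int i')"
      using dvd_trans[OF dvd_triv_right d] by (simp add: dvd_add_left_iff)
    then have "int Q dvd int i - int i'"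
      using assms(3) by (simp add: coprime_dvd_mult_right_iff coprime_commute)
    then have "i = i'"
      using ij by (metis mod_eq_dvd_iff of_nat_mod mod_less of_nat_eq_iff)
    have "int P dvd int Q * (int j - int j')"
      using dvd_trans[OF dvd_triv_left d] by (simp add: dvd_add_right_iff)
    then have "int P dvd int j - int j'"
      using assms(3) by (simp add: coprime_dvd_mult_right_iff coprime_commute)
    then have "j = j'"
      using ij by (metis mod_eq_dvd_iff of_nat_mod mod_less of_nat_eq_iff)
    show "s = s' \<and> r = r'" using ij \<open>i = i'\<close> \<open>j = j'\<close> by simp
  qed
qed

text \<open>
  As the progression contains \<open>0\<close>, a period \<open>g\<close> is one of its terms, say \<open>g = i k\<close>. Translation
  by \<open>g\<close> then produces \<open>a k\<close>, which is less than \<open>N\<close> and not in the progression.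
\<close>

lemma not_periodic_multiples_mod:
  assumes "a > 0" "a * k < N"
  shows "\<not> periodic (integer_mod_group N) (multiples_mod N k a)"
proof
  let ?T = "multiples_mod N k a"
  have T: "?T = {int (j * k) | j. j < a}" using assms by (simp add: multiples_mod_eq)
  assume "periodic (integer_mod_group N) ?T"
  then obtain g where g: "0 \<le> g" "g < int N" "g \<noteq> 0"
    and fixed: "?T #>\<^bsub>integer_mod_group N\<^esub> g = ?T"
    using assms unfolding periodic_def by (auto simp: carrier_integer_mod_group)
  have shift: "(t + g) mod int N \<in> ?T" if "t \<in> ?T" for t
    using fixed that unfolding r_coset_def by (auto simp: mult_integer_mod_group)
  have "0 \<in> ?T" using assms unfolding T by auto
  then have "g \<in> ?T" using shift[of 0] g by simp
  then obtain i where i: "i < a" "g = int (i * k)" unfolding T by blast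
  have ik: "i > 0" "k > 0" using i g by auto
  have "a - i < a" using ik i by simp
  then have "int ((a - i) * k) \<in> ?T" unfolding T by blast
  moreover have "int ((a - i) * k) + g = int (a * k)"
    using i by (simp add: diff_mult_distrib of_nat_diff)
  ultimately have "int (a * k) \<in> ?T" using shift assms by (metis of_nat_mod mod_less)
  then show False using ik unfolding T by auto
qed

section \<open>The construction of Vuza canons\<close>

theorem theorem17:
  fixes p\<^sub>1 p\<^sub>2 n\<^sub>1 n\<^sub>2 n\<^sub>3 N n m :: nat
    and Z :: "int monoid"
    and H K K\<^sub>1 K\<^sub>2 A B U V U' V' S R :: "int set"
    and u b v a :: "nat \<Rightarrow> int"
  assumes "prime p\<^sub>1" and "prime p\<^sub>2" and "p\<^sub>1 \<noteq> p\<^sub>2"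
    and "n\<^sub>1 > 0" and "n\<^sub>2 > 0" and "n\<^sub>3 > 0"
    and "coprime (n\<^sub>1 * p\<^sub>1) (n\<^sub>2 * p\<^sub>2)"
    and "N = n\<^sub>1 * n\<^sub>2 * n\<^sub>3 * p\<^sub>1 * p\<^sub>2"
    and "Z = integer_mod_group N"
    and "H = multiples_mod N n\<^sub>3 (n\<^sub>1 * p\<^sub>1 * n\<^sub>2 * p\<^sub>2)"
    and "coset_representatives Z H K"
    and "K = K\<^sub>1 \<union> K\<^sub>2" and "K\<^sub>1 \<inter> K\<^sub>2 = {}"
    and "A = multiples_mod N (n\<^sub>1 * p\<^sub>1 * n\<^sub>3) n\<^sub>2"
    and "B = multiples_mod N (n\<^sub>2 * p\<^sub>2 * n\<^sub>3) n\<^sub>1"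
    and "U = multiples_mod N (n\<^sub>1 * n\<^sub>2 * n\<^sub>3 * p\<^sub>1) p\<^sub>2"
    and "V = multiples_mod N (n\<^sub>1 * n\<^sub>2 * n\<^sub>3 * p\<^sub>2) p\<^sub>1"
    and "inj_on u {1..n}" and "\<forall>i\<in>{1..n}. u i \<in> U - {0}" and "\<forall>i\<in>{1..n}. b i \<in> B - {0}"
    and "U' = (U - u ` {1..n}) \<union> (\<lambda>i. u i \<otimes>\<^bsub>Z\<^esub> b i) ` {1..n}"
    and "inj_on v {1..m}" and "\<forall>i\<in>{1..m}. v i \<in> V - {0}" and "\<forall>i\<in>{1..m}. a i \<in> A - {0}"
    and "V' = (V - v ` {1..m}) \<union> (\<lambda>i. v i \<otimes>\<^bsub>Z\<^esub> a i) ` {1..m}"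
    and "S = A <#>\<^bsub>Z\<^esub> B"
    and "R = ((U <#>\<^bsub>Z\<^esub> V') <#>\<^bsub>Z\<^esub> K\<^sub>1) \<union> ((U' <#>\<^bsub>Z\<^esub> V) <#>\<^bsub>Z\<^esub> K\<^sub>2)"
    and "\<not> periodic Z R"
  shows "vuza_canon Z S R"
proof -
  define P where "P = n\<^sub>1 * p\<^sub>1"
  define Q where "Q = n\<^sub>2 * p\<^sub>2"
  define L where "L = multiples_mod N (P * n\<^sub>3) Q"
  define M where "M = multiples_mod N (Q * n\<^sub>3) P"
  have p: "p\<^sub>1 > 1" "p\<^sub>2 > 1" using assms(1,2) prime_gt_1_nat by auto
  have NPQ: "N = P * Q * n\<^sub>3" and N0: "N > 0"
    using assms(4-6,8) p by (auto simp: P_def Q_def)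
  interpret comm_group Z unfolding assms(9) by (rule abelian_integer_mod_group)
  have H: "H = multiples_mod N n\<^sub>3 (P * Q)" using assms(10) by (simp add: P_def Q_def mult_ac)
  have A: "A = multiples_mod N (P * n\<^sub>3) n\<^sub>2" using assms(14) by (simp add: P_def)
  have B: "B = multiples_mod N (Q * n\<^sub>3) n\<^sub>1" using assms(15) by (simp add: Q_def)
  have U: "U = multiples_mod N (n\<^sub>2 * (P * n\<^sub>3)) p\<^sub>2" using assms(16) by (simp add: P_def mult_ac)
  have V: "V = multiples_mod N (n\<^sub>1 * (Q * n\<^sub>3)) p\<^sub>1" using assms(17) by (simp add: Q_def mult_ac)
  have subH: "subgroup H Z" unfolding H assms(9)
    by (rule subgroup_multiples_mod) (use NPQ N0 in auto)
  have subL: "subgroup L Z" unfolding L_def assms(9)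
    by (rule subgroup_multiples_mod) (use NPQ N0 in auto)
  have subM: "subgroup M Z" unfolding M_def assms(9)
    by (rule subgroup_multiples_mod) (use NPQ N0 in auto)
  have HLM: "direct_factorization (Z\<lparr>carrier := H\<rparr>) L M"
    unfolding H L_def M_def assms(9)
    by (rule multiples_mod_coprime) (use NPQ N0 assms(7) in \<open>auto simp: P_def Q_def\<close>)
  have LAU: "direct_factorization (Z\<lparr>carrier := L\<rparr>) A U"
    unfolding L_def A U assms(9) Q_def
    by (rule multiples_mod_split) (use NPQ N0 in \<open>auto simp: Q_def mult_ac\<close>)
  have MBV: "direct_factorization (Z\<lparr>carrier := M\<rparr>) B V"
    unfolding M_def B V assms(9) P_def
    by (rule multiples_mod_split) (use NPQ N0 in \<open>auto simp: P_def mult_ac\<close>)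
  note DL = direct_factorizationD[OF LAU, simplified] and DM = direct_factorizationD[OF MBV, simplified]
  have "U \<subseteq> carrier Z" "V \<subseteq> carrier Z"
    using DL(4) DM(4) subgroup.subset[OF subL] subgroup.subset[OF subM] by auto
  obtain f where f: "f \<in> U \<rightarrow> M" "U' = (\<lambda>x. x \<otimes>\<^bsub>Z\<^esub> f x) ` U"
    using replacement_eq_image[of U u "{1..n}" b M] \<open>U \<subseteq> carrier Z\<close> assms(18-21) DM(3)
      subgroup.one_closed[OF subM] by blast
  obtain h where h: "h \<in> V \<rightarrow> L" "V' = (\<lambda>x. x \<otimes>\<^bsub>Z\<^esub> h x) ` V"
    using replacement_eq_image[of V v "{1..m}" a L] \<open>V \<subseteq> carrier Z\<close> assms(22-25) DL(3)
      subgroup.one_closed[OF subL] by blast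
  have HUV': "direct_factorization (Z\<lparr>carrier := H\<rparr>) S (U <#>\<^bsub>Z\<^esub> V')"
    unfolding assms(26) h(2)
    by (rule direct_factorization_exchange[OF subH subL subM HLM LAU MBV h(1)])
  have comm: "X <#>\<^bsub>Z\<^esub> Y = Y <#>\<^bsub>Z\<^esub> X" if "X \<subseteq> carrier Z" "Y \<subseteq> carrier Z" for X Y
    using that m_comm unfolding set_mult_def by blast
  have U'c: "U' \<subseteq> carrier Z"
    unfolding f(2) using f(1) \<open>U \<subseteq> carrier Z\<close> subgroup.subset[OF subM] by auto
  have AB: "A \<subseteq> carrier Z" "B \<subseteq> carrier Z"
    using DL(3) DM(3) subgroup.subset[OF subL] subgroup.subset[OF subM] by auto
  \<comment> \<open>The mirror image of the previous factorization, with \<open>L\<close> and \<open>M\<close> in exchanged roles.\<close>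
  have HU'V: "direct_factorization (Z\<lparr>carrier := H\<rparr>) S (U' <#>\<^bsub>Z\<^esub> V)"
    using direct_factorization_exchange[OF subH subM subL
        direct_factorization_commute[OF HLM subH] MBV LAU f(1)]
    unfolding assms(26) f(2)[symmetric]
    by (simp add: comm[OF AB] comm[OF U'c \<open>V \<subseteq> carrier Z\<close>])
  have translates: "X <#>\<^bsub>Z\<^esub> Y = (\<Union>k\<in>Y. X #>\<^bsub>Z\<^esub> k)" for X Y
    unfolding set_mult_def r_coset_def by blast
  \<comment> \<open>The two complements of \<open>S\<close> in \<open>H\<close>, distributed over the cosets as \<open>K\<^sub>1\<close> and \<open>K\<^sub>2\<close> prescribe.\<close>
  let ?R = "\<lambda>k. if k \<in> K\<^sub>1 then U <#>\<^bsub>Z\<^esub> V' else U' <#>\<^bsub>Z\<^esub> V"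
  have "direct_factorization Z S (\<Union>k\<in>K. ?R k #>\<^bsub>Z\<^esub> k)"
    by (rule direct_factorization_glue[OF subH
          coset_representatives_direct_factorization[OF subH assms(11)]])
      (use HUV' HU'V in auto)
  also have "(\<Union>k\<in>K. ?R k #>\<^bsub>Z\<^esub> k)
      = (\<Union>k\<in>K\<^sub>1. ?R k #>\<^bsub>Z\<^esub> k) \<union> (\<Union>k\<in>K\<^sub>2. ?R k #>\<^bsub>Z\<^esub> k)"
    unfolding assms(12) by (rule UN_Un)
  also have "(\<Union>k\<in>K\<^sub>1. ?R k #>\<^bsub>Z\<^esub> k) = (\<Union>k\<in>K\<^sub>1. (U <#>\<^bsub>Z\<^esub> V') #>\<^bsub>Z\<^esub> k)"
    by (rule SUP_cong) auto
  also have "(\<Union>k\<in>K\<^sub>2. ?R k #>\<^bsub>Z\<^esub> k) = (\<Union>k\<in>K\<^sub>2. (U' <#>\<^bsub>Z\<^esub> V) #>\<^bsub>Z\<^esub> k)"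
    by (rule SUP_cong) (use assms(13) in auto)
  also have "(\<Union>k\<in>K\<^sub>1. (U <#>\<^bsub>Z\<^esub> V') #>\<^bsub>Z\<^esub> k) \<union> (\<Union>k\<in>K\<^sub>2. (U' <#>\<^bsub>Z\<^esub> V) #>\<^bsub>Z\<^esub> k) = R"
    unfolding assms(27) translates[symmetric] ..
  finally have fact: "direct_factorization Z S R" .
  have "n\<^sub>2 * (P * n\<^sub>3) < N" "n\<^sub>1 * (Q * n\<^sub>3) < N"
    using assms(4-6) p unfolding assms(8) P_def Q_def by auto
  then have "\<not> periodic Z A" "\<not> periodic Z B"
    unfolding A B assms(9)
    by (simp_all only: not_periodic_multiples_mod[OF assms(5)]
        not_periodic_multiples_mod[OF assms(4)] not_False_eq_True)
  then have "\<not> periodic Z S"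
    unfolding assms(26) using not_periodic_set_mult[OF subH subL subM HLM] DL DM by blast
  then show ?thesis using fact assms(28) unfolding vuza_canon_def by blast
qed

end
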